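(* Let $S$ be a $\Gamma$-semigroup. The following are equivalent: (1) $S$ is regular; (2) for every intuitionistic fuzzy right ideal $A=(\mu_A,\nu_A)$ of $S$ and every intuitionistic fuzzy left ideal $B=(\mu_B,\nu_B)$ of $S$, $A\circ B=A\cap B$.
   Context: $\Gamma$-semigroup (both sided): non-empty sets $S,\Gamma$ with maps $S\times\Gamma\times S\to S$, $(a,\alpha,b)\mapsto a\alpha b$, and $\Gamma\times S\times\Gamma\to\Gamma$, $(\alpha,a,\beta)\mapsto\alpha a\beta$, such that $(a\alpha b)\beta c=a(\alpha b\beta)c=a\alpha(b\beta c)$ and $\alpha(a\beta b)\gamma=(\alpha a\beta)b\gamma=\alpha a(\beta b\gamma)$ for all $a,b,c\in S$, $\alpha,\beta,\gamma\in\Gamma$. $S$ is regular if for every $c\in S$ there exist $x\in S$ and $\gamma_1,\gamma_2\in\Gamma$ with $c=c\gamma_1x\gamma_2c$. An intuitionistic fuzzy set (IFS) of $S$ is a pair $A=(\mu_A,\nu_A)$ of functions $S\to[0,1]$ with $\mu_A(x)+\nu_A(x)\le1$ for all $x$. It is non-empty if there is $x\in S$ with $\mu_A(x)\ne0$ and $\nu_A(x)\neq1$. Two IFS are equal if both component functions agree. A non-empty IFS $A$ is an intuitionistic fuzzy left ideal if $\mu_A(x\gamma y)\ge\mu_A(y)$ and $\nu_A(x\gamma y)\le\nu_A(y)$ for all $x,y\in S,\gamma\in\Gamma$; it is an intuitionistic fuzzy right ideal if $\mu_A(x\gamma y)\ge\mu_A(x)$ and $\nu_A(x\gamma y)\le\nu_A(x)$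 for all $x,y\in S,\gamma\in\Gamma$. $A\cap B=(\min\{\mu_A,\mu_B\},\max\{\nu_A,\nu_B\})$ pointwise. The product $A\circ B=(\mu_{A\circ B},\nu_{A\circ B})$ is given by $\mu_{A\circ B}(x)=\sup\{\min\{\mu_A(u),\mu_B(v)\}: u,v\in S,\gamma\in\Gamma,\ x=u\gamma v\}$ and $\nu_{A\circ B}(x)=\inf\{\max\{\nu_A(u),\nu_B(v)\}: u,v\in S,\gamma\in\Gamma,\ x=u\gamma v\}$ if $x$ can be written as $u\gamma v$, and $\mu_{A\circ B}(x)=0$, $\nu_{A\circ B}(x)=1$ otherwise. *)

theory Defs
  imports Complex_Main
begin

locale gamma_semigroup =
  fixes S :: "'a set" and G :: "'g set"
    and mulS :: "'a \<Rightarrow> 'g \<Rightarrow> 'a \<Rightarrow> 'a"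
    and mulG :: "'g \<Rightarrow> 'a \<Rightarrow> 'g \<Rightarrow> 'g"
  assumes S_nonempty: "S \<noteq> {}"
    and G_nonempty: "G \<noteq> {}"
    and mulS_closed: "\<And>a \<alpha> b. \<lbrakk>a \<in> S; \<alpha> \<in> G; b \<in> S\<rbrakk> \<Longrightarrow> mulS a \<alpha> b \<in> S"
    and mulG_closed: "\<And>\<alpha> a \<beta>. \<lbrakk>\<alpha> \<in> G; a \<in> S; \<beta> \<in> G\<rbrakk> \<Longrightarrow> mulG \<alpha> a \<beta> \<in> G"
    and S_assoc_left: "\<And>a b c \<alpha> \<beta>. \<lbrakk>a \<in> S; b \<in> S; c \<in> S; \<alpha> \<in> G; \<beta> \<in> G\<rbrakk>
          \<Longrightarrow> mulS (mulS a \<alpha> b) \<beta> c = mulS a (mulG \<alpha> b \<beta>) c"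
    and S_assoc_right: "\<And>a b c \<alpha> \<beta>. \<lbrakk>a \<in> S; b \<in> S; c \<in> S; \<alpha> \<in> G; \<beta> \<in> G\<rbrakk>
          \<Longrightarrow> mulS a (mulG \<alpha> b \<beta>) c = mulS a \<alpha> (mulS b \<beta> c)"
    and G_assoc_left: "\<And>a b \<alpha> \<beta> \<gamma>. \<lbrakk>a \<in> S; b \<in> S; \<alpha> \<in> G; \<beta> \<in> G; \<gamma> \<in> G\<rbrakk>
          \<Longrightarrow> mulG \<alpha> (mulS a \<beta> b) \<gamma> = mulG (mulG \<alpha> a \<beta>) b \<gamma>"
    and G_assoc_right: "\<And>a b \<alpha> \<beta> \<gamma>. \<lbrakk>a \<in> S; b \<in> S; \<alpha> \<in> G; \<beta> \<in> G; \<gamma> \<in> G\<rbrakk>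
          \<Longrightarrow> mulG (mulG \<alpha> a \<beta>) b \<gamma> = mulG \<alpha> a (mulG \<beta> b \<gamma>)"

definition gamma_regular :: "'a set \<Rightarrow> 'g set \<Rightarrow> ('a \<Rightarrow> 'g \<Rightarrow> 'a \<Rightarrow> 'a) \<Rightarrow> bool" where
  "gamma_regular S G mulS \<longleftrightarrow>
     (\<forall>c\<in>S. \<exists>x\<in>S. \<exists>\<gamma>1\<in>G. \<exists>\<gamma>2\<in>G. c = mulS (mulS c \<gamma>1 x) \<gamma>2 c)"

text \<open>
  A pair of membership and non-membership functions. Functions on the carrier set are
  represented by total functions, whose values outside the carrier are irrelevant; hence
  equality of intuitionistic fuzzy sets of \<open>S\<close> is the relation \<open>ifs_eq S\<close>.
\<close>

type_synonym 'a ifs = "('a \<Rightarrow> real) \<times> ('a \<Rightarrow> real)"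

abbreviation mu :: "'a ifs \<Rightarrow> 'a \<Rightarrow> real" where "mu A \<equiv> fst A"
abbreviation nu :: "'a ifs \<Rightarrow> 'a \<Rightarrow> real" where "nu A \<equiv> snd A"

definition is_ifs :: "'a set \<Rightarrow> 'a ifs \<Rightarrow> bool" where
  "is_ifs S A \<longleftrightarrow>
     (\<forall>x\<in>S. mu A x \<in> {0..1} \<and> nu A x \<in> {0..1} \<and> mu A x + nu A x \<le> 1)"

definition ifs_nonempty :: "'a set \<Rightarrow> 'a ifs \<Rightarrow> bool" where
  "ifs_nonempty S A \<longleftrightarrow> (\<exists>x\<in>S. mu A x \<noteq> 0 \<and> nu A x \<noteq> 1)"

definition ifs_eq :: "'a set \<Rightarrow> 'a ifs \<Rightarrow> 'a ifs \<Rightarrow> bool" where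
  "ifs_eq S A B \<longleftrightarrow> (\<forall>x\<in>S. mu A x = mu B x \<and> nu A x = nu B x)"

definition if_left_ideal ::
    "'a set \<Rightarrow> 'g set \<Rightarrow> ('a \<Rightarrow> 'g \<Rightarrow> 'a \<Rightarrow> 'a) \<Rightarrow> 'a ifs \<Rightarrow> bool" where
  "if_left_ideal S G mulS A \<longleftrightarrow> is_ifs S A \<and> ifs_nonempty S A \<and>
     (\<forall>x\<in>S. \<forall>y\<in>S. \<forall>\<gamma>\<in>G.
        mu A (mulS x \<gamma> y) \<ge> mu A y \<and> nu A (mulS x \<gamma> y) \<le> nu A y)"

definition if_right_ideal ::
    "'a set \<Rightarrow> 'g set \<Rightarrow> ('a \<Rightarrow> 'g \<Rightarrow> 'a \<Rightarrow> 'a) \<Rightarrow> 'a ifs \<Rightarrow> bool" where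
  "if_right_ideal S G mulS A \<longleftrightarrow> is_ifs S A \<and> ifs_nonempty S A \<and>
     (\<forall>x\<in>S. \<forall>y\<in>S. \<forall>\<gamma>\<in>G.
        mu A (mulS x \<gamma> y) \<ge> mu A x \<and> nu A (mulS x \<gamma> y) \<le> nu A x)"

definition ifs_inter :: "'a ifs \<Rightarrow> 'a ifs \<Rightarrow> 'a ifs" where
  "ifs_inter A B = (\<lambda>x. min (mu A x) (mu B x), \<lambda>x. max (nu A x) (nu B x))"

definition ifs_prod ::
    "'a set \<Rightarrow> 'g set \<Rightarrow> ('a \<Rightarrow> 'g \<Rightarrow> 'a \<Rightarrow> 'a) \<Rightarrow> 'a ifs \<Rightarrow> 'a ifs \<Rightarrow> 'a ifs" where
  "ifs_prod S G mulS A B =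
     (\<lambda>x. if \<exists>u\<in>S. \<exists>v\<in>S. \<exists>\<gamma>\<in>G. x = mulS u \<gamma> v
          then Sup {min (mu A u) (mu B v) | u v \<gamma>. u \<in> S \<and> v \<in> S \<and> \<gamma> \<in> G \<and> x = mulS u \<gamma> v}
          else 0,
      \<lambda>x. if \<exists>u\<in>S. \<exists>v\<in>S. \<exists>\<gamma>\<in>G. x = mulS u \<gamma> v
          then Inf {max (nu A u) (nu B v) | u v \<gamma>. u \<in> S \<and> v \<in> S \<and> \<gamma> \<in> G \<and> x = mulS u \<gamma> v}
          else 1)"

end

(*
  For a right ideal A and a left ideal B, every factorization x = u \<gamma> v contributes at most
  min (mu A x) (mu B x) to the supremum, and dually for the infimum; regularity supplies the
  factorization c = (c \<gamma>1 x) \<gamma>2 c, at which the bound is attained. Conversely, apply the identity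
  to the characteristic fuzzy sets of the principal right and left ideals of c: membership
  of c in their product means that c = u \<gamma> v with u in {c} \<union> c G S and v in {c} \<union> S G c, and each of
  the four cases gives regularity at c.
*)
theory Submission imports Defs begin

text \<open>The indicator pair turns a crisp set into an intuitionistic fuzzy set. \<open>U\<close>
  may be any set of the ambient type, since only the values on \<open>S\<close> count.\<close>

definition char_ifs :: "'a set \<Rightarrow> 'a ifs" where
  "char_ifs U = (\<lambda>x. of_bool (x \<in> U), \<lambda>x. of_bool (x \<notin> U))"

context gamma_semigroup
begin

lemma mulS_assoc:
  assumes "a \<in> S" "b \<in> S" "c \<in> S" "\<alpha> \<in> G" "\<beta> \<in> G"
  shows "mulS (mulS a \<alpha> b) \<beta> c = mulS a \<alpha> (mulS b \<beta> c)"
  using S_assoc_left S_assoc_right assms by metis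

lemma ifs_prod_eq_inter_at:
  assumes A: "if_right_ideal S G mulS A" and B: "if_left_ideal S G mulS B"
    and c: "c \<in> S" "x \<in> S" "\<gamma>1 \<in> G" "\<gamma>2 \<in> G" "c = mulS (mulS c \<gamma>1 x) \<gamma>2 c"
  shows "mu (ifs_prod S G mulS A B) c = min (mu A c) (mu B c)"
    and "nu (ifs_prod S G mulS A B) c = max (nu A c) (nu B c)"
proof -
  let ?u = "mulS c \<gamma>1 x"
  have u: "?u \<in> S" using c mulS_closed by blast
  have ex: "\<exists>u\<in>S. \<exists>v\<in>S. \<exists>\<gamma>\<in>G. c = mulS u \<gamma> v" using u c by blast
  have le: "mu A u \<le> mu A c" "mu B v \<le> mu B c" "nu A c \<le> nu A u" "nu B c \<le> nu B v"
    if "u \<in> S" "v \<in> S" "\<gamma> \<in> G" "c = mulS u \<gamma> v" for u v \<gamma>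
    using A B that unfolding if_right_ideal_def if_left_ideal_def by auto
  have "mu A c \<le> mu A ?u" "nu A ?u \<le> nu A c"
    using A c unfolding if_right_ideal_def by auto
  \<comment> \<open>\<open>A\<close> takes the same values at \<open>?u\<close> and
    \<open>c\<close>, since each is a right multiple of the other: \<open>?u\<close> is c \<gamma>1
    x and \<open>c\<close> is \<open>?u\<close> \<gamma>2 c.\<close>
  with le[OF u c(1,4,5)] have eq: "mu A ?u = mu A c" "nu A ?u = nu A c" by auto
  \<comment> \<open>The factorization into \<open>?u\<close> and \<open>c\<close> attains the upper
    bound, so the supremum is a maximum; no separate boundedness argument arises.\<close>
  have "Sup {min (mu A u) (mu B v) | u v \<gamma>. u \<in> S \<and> v \<in> S \<and> \<gamma> \<in> G \<and> c = mulS u \<gamma> v}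
      = min (mu A c) (mu B c)"
  proof (rule cSup_eq_maximum)
    show "min (mu A c) (mu B c) \<in>
        {min (mu A u) (mu B v) | u v \<gamma>. u \<in> S \<and> v \<in> S \<and> \<gamma> \<in> G \<and> c = mulS u \<gamma> v}"
      using u c eq by (intro CollectI exI[of _ ?u] exI[of _ c] exI[of _ \<gamma>2]) simp
  next
    fix y
    assume "y \<in> {min (mu A u) (mu B v) | u v \<gamma>. u \<in> S \<and> v \<in> S \<and> \<gamma> \<in> G \<and> c = mulS u \<gamma> v}"
    then obtain u v \<gamma> where y: "y = min (mu A u) (mu B v)"
      and uv: "u \<in> S" "v \<in> S" "\<gamma> \<in> G" "c = mulS u \<gamma> v" by blast
    show "y \<le> min (mu A c) (mu B c)"
      unfolding y using le[OF uv] by (intro min.mono)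
  qed
  then show "mu (ifs_prod S G mulS A B) c = min (mu A c) (mu B c)"
    using ex by (simp add: ifs_prod_def)
  have "Inf {max (nu A u) (nu B v) | u v \<gamma>. u \<in> S \<and> v \<in> S \<and> \<gamma> \<in> G \<and> c = mulS u \<gamma> v}
      = max (nu A c) (nu B c)"
  proof (rule cInf_eq_minimum)
    show "max (nu A c) (nu B c) \<in>
        {max (nu A u) (nu B v) | u v \<gamma>. u \<in> S \<and> v \<in> S \<and> \<gamma> \<in> G \<and> c = mulS u \<gamma> v}"
      using u c eq by (intro CollectI exI[of _ ?u] exI[of _ c] exI[of _ \<gamma>2]) simp
  next
    fix y
    assume "y \<in> {max (nu A u) (nu B v) | u v \<gamma>. u \<in> S \<and> v \<in> S \<and> \<gamma> \<in> G \<and> c = mulS u \<gamma> v}"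
    then obtain u v \<gamma> where y: "y = max (nu A u) (nu B v)"
      and uv: "u \<in> S" "v \<in> S" "\<gamma> \<in> G" "c = mulS u \<gamma> v" by blast
    show "max (nu A c) (nu B c) \<le> y"
      unfolding y using le[OF uv] by (intro max.mono)
  qed
  then show "nu (ifs_prod S G mulS A B) c = max (nu A c) (nu B c)"
    using ex by (simp add: ifs_prod_def)
qed

text \<open>For an indicator pair, both ideal inequalities just say that membership in
  \<open>U\<close> passes from \<open>x\<close> to the product; the point \<open>c\<close> witnesses
  non-emptiness.\<close>

lemma char_ifs_right_ideal:
  assumes "c \<in> S" "c \<in> U"
    and "\<And>x y \<gamma>. \<lbrakk>x \<in> S; x \<in> U; y \<in> S; \<gamma> \<in> G\<rbrakk> \<Longrightarrow> mulS x \<gamma> y \<in> U"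
  shows "if_right_ideal S G mulS (char_ifs U)"
  unfolding if_right_ideal_def
proof (intro conjI ballI)
  show "is_ifs S (char_ifs U)"
    by (simp add: is_ifs_def char_ifs_def)
  show "ifs_nonempty S (char_ifs U)"
    unfolding ifs_nonempty_def using assms(1,2) by (intro bexI[of _ c]) (simp_all add: char_ifs_def)
  fix x y \<gamma>
  assume "x \<in> S" "y \<in> S" "\<gamma> \<in> G"
  with assms(3) have "x \<in> U \<Longrightarrow> mulS x \<gamma> y \<in> U" by blast
  then show "mu (char_ifs U) x \<le> mu (char_ifs U) (mulS x \<gamma> y)"
    and "nu (char_ifs U) (mulS x \<gamma> y) \<le> nu (char_ifs U) x"
    by (cases "x \<in> U"; simp add: char_ifs_def)+
qed

lemma char_ifs_left_ideal:
  assumes "c \<in> S" "c \<in> U"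
    and "\<And>x y \<gamma>. \<lbrakk>x \<in> S; y \<in> S; y \<in> U; \<gamma> \<in> G\<rbrakk> \<Longrightarrow> mulS x \<gamma> y \<in> U"
  shows "if_left_ideal S G mulS (char_ifs U)"
  unfolding if_left_ideal_def
proof (intro conjI ballI)
  show "is_ifs S (char_ifs U)"
    by (simp add: is_ifs_def char_ifs_def)
  show "ifs_nonempty S (char_ifs U)"
    unfolding ifs_nonempty_def using assms(1,2) by (intro bexI[of _ c]) (simp_all add: char_ifs_def)
  fix x y \<gamma>
  assume "x \<in> S" "y \<in> S" "\<gamma> \<in> G"
  with assms(3) have "y \<in> U \<Longrightarrow> mulS x \<gamma> y \<in> U" by blast
  then show "mu (char_ifs U) y \<le> mu (char_ifs U) (mulS x \<gamma> y)"
    and "nu (char_ifs U) (mulS x \<gamma> y) \<le> nu (char_ifs U) y"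
    by (cases "y \<in> U"; simp add: char_ifs_def)+
qed

text \<open>Every minimum of two indicator values is 0 or 1, so without a factorization inside
  \<open>U\<close> and \<open>V\<close> the supremum could only be 0.\<close>

lemma char_ifs_prod_nonzero:
  assumes nz: "mu (ifs_prod S G mulS (char_ifs U) (char_ifs V)) x \<noteq> 0"
  obtains u v \<gamma> where "u \<in> S" "v \<in> S" "\<gamma> \<in> G" "u \<in> U" "v \<in> V" "x = mulS u \<gamma> v"
proof (rule ccontr)
  assume "\<not> thesis"
  with that have no: "\<not> (u \<in> U \<and> v \<in> V)"
    if "u \<in> S" "v \<in> S" "\<gamma> \<in> G" "x = mulS u \<gamma> v" for u v \<gamma>
    using that by blast
  let ?M = "{min (mu (char_ifs U) u) (mu (char_ifs V) v) | u v \<gamma>.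
               u \<in> S \<and> v \<in> S \<and> \<gamma> \<in> G \<and> x = mulS u \<gamma> v}"
  \<comment> \<open>The default value 0 of the product forces \<open>x\<close> to have some
    factorization. Hence \<open>?M\<close> is non-empty, which matters because the real
    \<open>Sup\<close> of the empty set is unspecified.\<close>
  from nz have ex: "\<exists>u\<in>S. \<exists>v\<in>S. \<exists>\<gamma>\<in>G. x = mulS u \<gamma> v"
    and sup: "Sup ?M \<noteq> 0"
    by (auto simp: ifs_prod_def split: if_splits)
  have "?M \<subseteq> {0}"
    using no by (auto simp: char_ifs_def)
  then have "?M = {} \<or> ?M = {0}" by (rule subset_singletonD)
  moreover have "?M \<noteq> {}" using ex by blast
  ultimately have "?M = {0}" by argo
  with sup show False by simp
qed

text \<open>Multiplying on the right moves even the adjoined generator \<open>c\<close> into c G S.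
  This shows that the principal right ideal is closed, and it later rewrites a product without
  asking whether its left factor is \<open>c\<close>.\<close>

lemma principal_right_ideal_mult:
  assumes "c \<in> S" "x \<in> insert c {mulS c \<delta> s | \<delta> s. \<delta> \<in> G \<and> s \<in> S}" "y \<in> S" "\<gamma> \<in> G"
  obtains \<delta> s where "\<delta> \<in> G" "s \<in> S" "mulS x \<gamma> y = mulS c \<delta> s"
proof (cases "x = c")
  case True
  show ?thesis using that[OF assms(4,3)] True by simp
next
  case False
  with assms(2) obtain \<delta> s where x: "\<delta> \<in> G" "s \<in> S" "x = mulS c \<delta> s" by blast
  have "mulS x \<gamma> y = mulS c \<delta> (mulS s \<gamma> y)"
    unfolding x(3) by (rule mulS_assoc[OF assms(1) x(2) assms(3) x(1) assms(4)])
  then show ?thesis by (rule that[OF x(1) mulS_closed[OF x(2) assms(4,3)]])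
qed

lemma principal_left_ideal_mult:
  assumes "c \<in> S" "y \<in> insert c {mulS s \<delta> c | s \<delta>. s \<in> S \<and> \<delta> \<in> G}" "x \<in> S" "\<gamma> \<in> G"
  obtains s \<delta> where "s \<in> S" "\<delta> \<in> G" "mulS x \<gamma> y = mulS s \<delta> c"
proof (cases "y = c")
  case True
  show ?thesis using that[OF assms(3,4)] True by simp
next
  case False
  with assms(2) obtain s \<delta> where y: "s \<in> S" "\<delta> \<in> G" "y = mulS s \<delta> c" by blast
  have "mulS x \<gamma> y = mulS (mulS x \<gamma> s) \<delta> c"
    unfolding y(3) by (rule mulS_assoc[OF assms(3) y(1) assms(1) assms(4) y(2), symmetric])
  then show ?thesis by (rule that[OF mulS_closed[OF assms(3,4) y(1)] y(2)])
qed

lemma regular_at_if_prod_eq_inter: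
  assumes H: "\<And>A B. \<lbrakk>if_right_ideal S G mulS A; if_left_ideal S G mulS B\<rbrakk>
                \<Longrightarrow> ifs_eq S (ifs_prod S G mulS A B) (ifs_inter A B)"
    and c: "c \<in> S"
  shows "\<exists>x\<in>S. \<exists>\<gamma>1\<in>G. \<exists>\<gamma>2\<in>G. c = mulS (mulS c \<gamma>1 x) \<gamma>2 c"
proof -
  \<comment> \<open>Before regularity is known, \<open>c\<close> may lie outside c G S and S G c, so
    it is adjoined to make both indicators equal 1 at \<open>c\<close>.\<close>
  let ?R = "insert c {mulS c \<delta> s | \<delta> s. \<delta> \<in> G \<and> s \<in> S}"
  let ?L = "insert c {mulS s \<delta> c | s \<delta>. s \<in> S \<and> \<delta> \<in> G}"
  have "if_right_ideal S G mulS (char_ifs ?R)"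
    by (rule char_ifs_right_ideal[OF c]) (simp, erule (2) principal_right_ideal_mult[OF c], blast)
  moreover have "if_left_ideal S G mulS (char_ifs ?L)"
    by (rule char_ifs_left_ideal[OF c]) (simp, erule (2) principal_left_ideal_mult[OF c], blast)
  \<comment> \<open>At \<open>c\<close> the intersection has membership value 1, hence so does the
    product.\<close>
  ultimately have "mu (ifs_prod S G mulS (char_ifs ?R) (char_ifs ?L)) c \<noteq> 0"
    using H[of "char_ifs ?R" "char_ifs ?L"] c
    by (simp add: ifs_eq_def ifs_inter_def char_ifs_def)
  then obtain u v \<gamma> where uv: "u \<in> S" "v \<in> S" "\<gamma> \<in> G" "u \<in> ?R" "v \<in> ?L" "c = mulS u \<gamma> v"
    by (rule char_ifs_prod_nonzero)
  show ?thesis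
  proof (cases "v = c")
    case True
    show ?thesis
    proof (cases "u = c")
      case True
      have "mulS c \<gamma> c = c"
        using uv(6)[symmetric] unfolding \<open>u = c\<close> \<open>v = c\<close> .
      \<comment> \<open>Substituting the identity into itself produces the three-fold product, with
        \<open>c\<close> as its own middle element.\<close>
      then have "c = mulS (mulS c \<gamma> c) \<gamma> c" by simp
      then show ?thesis by (intro bexI[OF _ c] bexI[OF _ uv(3)])
    next
      case False
      with uv(4) obtain \<delta> s where s: "\<delta> \<in> G" "s \<in> S" "u = mulS c \<delta> s" by blast
      have "c = mulS (mulS c \<delta> s) \<gamma> c"
        using uv(6) unfolding s(3) \<open>v = c\<close> .
      then show ?thesis by (intro bexI[OF _ s(2)] bexI[OF _ s(1)] bexI[OF _ uv(3)])
    qed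
  next
    case False
    with uv(5) obtain t \<epsilon> where t: "t \<in> S" "\<epsilon> \<in> G" "v = mulS t \<epsilon> c" by blast
    \<comment> \<open>Both remaining cases for \<open>u\<close> are treated at once: after
      rebracketing, u \<gamma> t lies in c G S, whether or not \<open>u\<close> is \<open>c\<close>,
      and \<epsilon> c remains on the right.\<close>
    obtain \<delta> s where s: "\<delta> \<in> G" "s \<in> S" "mulS u \<gamma> t = mulS c \<delta> s"
      using principal_right_ideal_mult[OF c uv(4) t(1) uv(3)] .
    have "c = mulS (mulS u \<gamma> t) \<epsilon> c"
      using uv(6) unfolding t(3) mulS_assoc[OF uv(1) t(1) c uv(3) t(2)] .
    then have "c = mulS (mulS c \<delta> s) \<epsilon> c" unfolding s(3) .
    then show ?thesis by (intro bexI[OF _ s(2)] bexI[OF _ s(1)] bexI[OF _ t(2)])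
  qed
qed

end

theorem theorem3p20:
  fixes S :: "'a set" and G :: "'g set"
    and mulS :: "'a \<Rightarrow> 'g \<Rightarrow> 'a \<Rightarrow> 'a"
    and mulG :: "'g \<Rightarrow> 'a \<Rightarrow> 'g \<Rightarrow> 'g"
  assumes "gamma_semigroup S G mulS mulG"
  shows "gamma_regular S G mulS \<longleftrightarrow>
    (\<forall>A B. if_right_ideal S G mulS A \<longrightarrow> if_left_ideal S G mulS B \<longrightarrow>
       ifs_eq S (ifs_prod S G mulS A B) (ifs_inter A B))"
proof -
  interpret gamma_semigroup S G mulS mulG by fact
  show ?thesis
  proof
    assume "gamma_regular S G mulS"
    then have "mu (ifs_prod S G mulS A B) c = min (mu A c) (mu B c) \<and>
        nu (ifs_prod S G mulS A B) c = max (nu A c) (nu B c)"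
      if "if_right_ideal S G mulS A" "if_left_ideal S G mulS B" "c \<in> S" for A B c
      using ifs_prod_eq_inter_at[OF that] that(3) unfolding gamma_regular_def by blast
    then show "\<forall>A B. if_right_ideal S G mulS A \<longrightarrow> if_left_ideal S G mulS B \<longrightarrow>
       ifs_eq S (ifs_prod S G mulS A B) (ifs_inter A B)"
      by (simp add: ifs_eq_def ifs_inter_def)
  next
    assume "\<forall>A B. if_right_ideal S G mulS A \<longrightarrow> if_left_ideal S G mulS B \<longrightarrow>
       ifs_eq S (ifs_prod S G mulS A B) (ifs_inter A B)"
    then show "gamma_regular S G mulS"
      unfolding gamma_regular_def using regular_at_if_prod_eq_inter by blast
  qed
qed

end
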